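(* Let $P\subset\mathbb{R}^d$ be a $d$-dimensional convex polytope (with the origin in its interior). Then $P$ is second-order rigid if and only if for every first-order flex $\dot P$ of $P$ there is an equilibrium stress $\boldsymbol\xi$ of $P$ with $$\boldsymbol\xi^\top\,\mathcal R(\dot P)\,\dot P\neq 0 .$$
   Context: Let $P$ have vertex set $V$, edge set $E$ and facet set $F$; write $i\sim\sigma$ if vertex $i$ lies on facet $\sigma$, and let $V\!F$ be the set of incident vertex-facet pairs. $P$ is identified with the pair $(\boldsymbol p,\boldsymbol a)$ of maps $\boldsymbol p:V\to\mathbb{R}^d$ (vertices) and $\boldsymbol a:F\to\mathbb{R}^d$ (outward facet normals), scaled such that $\langle p_i,a_\sigma\rangle=1$ for $i\sim\sigma$ and $\langle p_i,a_\sigma\rangle<1$ for $i\not\sim\sigma$. Rigidity matrix: for any pair of maps $(\boldsymbol q,\boldsymbol b)$, $\boldsymbol q:V\to\mathbb{R}^d$, $\boldsymbol b:F\to\mathbb{R}^d$, $\mathcal R(\boldsymbol q,\boldsymbol b)$ is the $(|E|+|V\!F|)\times(d|V|+d|F|)$ matrix of the linear map sending $(\dot{\boldsymbol p},\dot{\boldsymbol a})\in\mathbb{R}^{dV}\oplus\mathbb{R}^{dF}$ to the vector with entries $\langle q_i-q_j,\dot p_i-\dot p_j\rangle$ for $ij\in E$ and $\langle q_i,\dot a_\sigma\rangle+\langle\dot p_i,b_\sigma\rangle$ for $i\sim\sigma$. Set $\mathcal R(P)=\mathcal R(\boldsymbol p,\boldsymbol a)$, and for $\dot P=(\dot{\boldsymbol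 p},\dot{\boldsymbol a})$ set $\mathcal R(\dot P)=\mathcal R(\dot{\boldsymbol p},\dot{\boldsymbol a})$. A first-order motion of $P$ is an element $\dot P=(\dot{\boldsymbol p},\dot{\boldsymbol a})$ of $\ker\mathcal R(P)$; it is trivial if $\langle p_i-p_j,\dot p_i-\dot p_j\rangle=0$ for all $i,j\in V$. A first-order flex is a non-trivial first-order motion. An equilibrium stress of $P$ is an element $\boldsymbol\xi\in\mathbb{R}^{E}\oplus\mathbb{R}^{V\!F}$ of $\ker\mathcal R(P)^\top$. A second-order motion of $P$ is a tuple $(\dot{\boldsymbol p},\dot{\boldsymbol a};\ddot{\boldsymbol p},\ddot{\boldsymbol a})$ such that $(\dot{\boldsymbol p},\dot{\boldsymbol a})$ is a first-order motion, $\langle p_i-p_j,\ddot p_i-\ddot p_j\rangle+\langle\dot p_i-\dot p_j,\dot p_i-\dot p_j\rangle=0$ for all $ij\in E$, and $\langle p_i,\ddot a_\sigma\rangle+2\langle\dot p_i,\dot a_\sigma\rangle+\langle\ddot p_i,a_\sigma\rangle=0$ for all $i\sim\sigma$. It is trivial if $(\dot{\boldsymbol p},\dot{\boldsymbol a})$ is trivial as a first-order motion. $P$ is second-order rigid if all its second-order motions are trivial. *)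

theory Defs
  imports "HOL-Analysis.Analysis" "HOL-Library.Uprod"
begin

section \<open>Vertices, edges, facets and facet normals\<close>

definition vertices :: "(real^'d) set \<Rightarrow> (real^'d) set"
  where "vertices P = {v. v extreme_point_of P}"

definition edges :: "(real^'d) set \<Rightarrow> (real^'d) uprod set"
  where "edges P = {Upair i j | i j. i \<in> vertices P \<and> j \<in> vertices P \<and> closed_segment i j edge_of P}"

definition facets :: "(real^'d) set \<Rightarrow> (real^'d) set set"
  where "facets P = {\<sigma>. \<sigma> facet_of P}"

definition incidences :: "(real^'d) set \<Rightarrow> ((real^'d) \<times> (real^'d) set) set"
  where "incidences P = {(i, \<sigma>). i \<in> vertices P \<and> \<sigma> \<in> facets P \<and> i \<in> \<sigma>}"

definition is_facet_normal :: "(real^'d) set \<Rightarrow> (real^'d) set \<Rightarrow> real^'d \<Rightarrow> bool"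
  where "is_facet_normal P \<sigma> n \<longleftrightarrow>
    (\<forall>i\<in>vertices P. (i \<in> \<sigma> \<longrightarrow> i \<bullet> n = 1) \<and> (i \<notin> \<sigma> \<longrightarrow> i \<bullet> n < 1))"

text \<open>Well defined for facets of a polytope with the origin in its interior; see
  \<open>is_facet_normal_ex1\<close> below.\<close>

definition facet_normal :: "(real^'d) set \<Rightarrow> (real^'d) set \<Rightarrow> real^'d"
  where "facet_normal P \<sigma> = (THE n. is_facet_normal P \<sigma> n)"

lemma is_facet_normal_ex1:
  fixes P :: "(real^'d) set"
  assumes poly: "polytope P" and zero: "0 \<in> interior P" and facet: "\<sigma> \<in> facets P"
  shows "\<exists>!n. is_facet_normal P \<sigma> n"
proof -
  have fo: "\<sigma> facet_of P" and face: "\<sigma> face_of P" and ne: "\<sigma> \<noteq> {}"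
    and dim: "aff_dim \<sigma> = aff_dim P - 1"
    using facet by (auto simp: facets_def facet_of_def)
  have dimP: "aff_dim P = int (DIM(real^'d))"
    using zero aff_dim_nonempty_interior[of P] by blast
  have "\<sigma> \<noteq> P" using dim by auto
  have "\<sigma> exposed_face_of P"
    using face poly exposed_face_of_polyhedron polytope_imp_polyhedron by blast
  then obtain a b where a: "a \<noteq> 0" and le: "P \<subseteq> {x. a \<bullet> x \<le> b}" and \<sigma>: "\<sigma> = P \<inter> {x. a \<bullet> x = b}"
    using ne \<open>\<sigma> \<noteq> P\<close> by (auto simp: exposed_face_of)
  have "interior P \<subseteq> {x. a \<bullet> x < b}"
    using interior_mono[OF le] a by simp
  then have b: "b > 0" using zero by auto
  define n where "n = a /\<^sub>R b"
  have n0: "n \<noteq> 0" using a b by (simp add: n_def)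
  have \<sigma>n: "\<sigma> = P \<inter> {x. n \<bullet> x = 1}" and Pn: "P \<subseteq> {x. n \<bullet> x \<le> 1}"
    using b \<sigma> le by (auto simp: n_def field_simps)
  have vP: "i \<in> P" if "i \<in> vertices P" for i
    using that by (simp add: vertices_def extreme_point_of_def)
  have ex: "is_facet_normal P \<sigma> n"
    unfolding is_facet_normal_def
  proof (intro ballI conjI impI)
    fix i assume i: "i \<in> vertices P"
    show "i \<bullet> n = 1" if "i \<in> \<sigma>" using that \<sigma>n by (auto simp: inner_commute)
    show "i \<bullet> n < 1" if "i \<notin> \<sigma>"
      using that \<sigma>n Pn vP[OF i] by (force simp: inner_commute)
  qed
  have "polytope \<sigma>" using poly face face_of_polytope_polytope by blast
  then have conv: "\<sigma> = convex hull {x. x extreme_point_of \<sigma>}"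
    by (simp add: Krein_Milman_Minkowski polytope_imp_compact polytope_imp_convex)
  have hyp: "affine hull \<sigma> = {x. m \<bullet> x = 1}" and hyp0: "m \<noteq> 0" if m: "is_facet_normal P \<sigma> m" for m
  proof -
    have "{x. x extreme_point_of \<sigma>} \<subseteq> {x. m \<bullet> x = 1}"
      using m face by (auto simp: is_facet_normal_def vertices_def extreme_point_of_face inner_commute)
    then have sub: "\<sigma> \<subseteq> {x. m \<bullet> x = 1}"
      by (metis conv convex_hyperplane hull_minimal)
    then show "m \<noteq> 0" using ne by auto
    have "affine hull \<sigma> \<subseteq> {x. m \<bullet> x = 1}"
      using sub by (simp add: affine_hyperplane hull_minimal)
    moreover have "aff_dim (affine hull \<sigma>) = aff_dim {x. m \<bullet> x = 1}"
      using dim dimP aff_dim_hyperplane[OF \<open>m \<noteq> 0\<close>, of 1] by simp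
    ultimately show "affine hull \<sigma> = {x. m \<bullet> x = 1}"
      using ne by (intro affine_dim_equal) (auto simp: affine_hyperplane)
  qed
  show ?thesis
  proof (rule ex1I[where a = n], rule ex)
    fix m assume m: "is_facet_normal P \<sigma> m"
    have eq: "{x. m \<bullet> x = 1} = {x. n \<bullet> x = 1}" and "m \<noteq> 0"
      using hyp[OF m] hyp[OF ex] hyp0[OF m] by auto
    show "m = n"
    proof (rule ccontr)
      assume "m \<noteq> n"
      let ?w = "m - n"
      define x0 where "x0 = n /\<^sub>R (n \<bullet> n)"
      have nx0: "n \<bullet> x0 = 1" using n0 by (simp add: x0_def)
      then have mx0: "m \<bullet> x0 = 1" using eq by blast
      define y where "y = ?w - (n \<bullet> ?w) *\<^sub>R x0"
      have ny: "n \<bullet> y = 0" using nx0 by (simp add: y_def inner_diff_right)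
      then have "n \<bullet> (x0 + y) = 1" using nx0 by (simp add: inner_add_right)
      then have "m \<bullet> (x0 + y) = 1" using eq by blast
      then have my: "m \<bullet> y = 0" using mx0 by (simp add: inner_add_right)
      have "?w \<bullet> x0 = 0" using nx0 mx0 by (simp add: inner_diff_left)
      then have "?w \<bullet> ?w = ?w \<bullet> y" by (simp add: y_def inner_diff_right)
      also have "\<dots> = 0" using ny my by (simp add: inner_diff_left)
      finally show False using \<open>m \<noteq> n\<close> by simp
    qed
  qed
qed


section \<open>Configurations and the rigidity matrix\<close>

text \<open>A pair of maps \<open>V \<rightarrow> \<real>\<^sup>d\<close>, \<open>F \<rightarrow> \<real>\<^sup>d\<close> is represented by a pair of total functions; everything
  below only depends on their values on the vertices and facets of the polytope. Likewise
  matrices and stresses are total functions of which only the entries indexed by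
  \<open>rigidity_rows\<close> (i.e. \<open>E + VF\<close>) and \<open>rigidity_cols\<close> (i.e. \<open>V \<times> d + F \<times> d\<close>) matter.\<close>

type_synonym 'd config = "((real^'d) \<Rightarrow> real^'d) \<times> ((real^'d) set \<Rightarrow> real^'d)"
type_synonym 'd rig_row = "(real^'d) uprod + ((real^'d) \<times> (real^'d) set)"
type_synonym 'd rig_col = "((real^'d) \<times> 'd) + ((real^'d) set \<times> 'd)"

definition polytope_config :: "(real^'d) set \<Rightarrow> 'd config"
  where "polytope_config P = (\<lambda>i. i, facet_normal P)"

definition rigidity_rows :: "(real^'d) set \<Rightarrow> 'd rig_row set"
  where "rigidity_rows P = edges P <+> incidences P"

definition rigidity_cols :: "(real^'d) set \<Rightarrow> 'd rig_col set"
  where "rigidity_cols P = (vertices P \<times> UNIV) <+> (facets P \<times> UNIV)"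

fun coords :: "('d::finite) config \<Rightarrow> 'd rig_col \<Rightarrow> real"
  where
    "coords (q, b) (Inl (i, k)) = q i $ k"
  | "coords (q, b) (Inr (\<sigma>, k)) = b \<sigma> $ k"

fun unit_config :: "('d::finite) rig_col \<Rightarrow> 'd config"
  where
    "unit_config (Inl (i, k)) = (\<lambda>j. if j = i then axis k 1 else 0, \<lambda>\<tau>. 0)"
  | "unit_config (Inr (\<sigma>, k)) = (\<lambda>j. 0, \<lambda>\<tau>. if \<tau> = \<sigma> then axis k 1 else 0)"

lift_definition edge_form ::
  "((real^'d) \<Rightarrow> real^'d) \<Rightarrow> ((real^'d) \<Rightarrow> real^'d) \<Rightarrow> (real^'d) uprod \<Rightarrow> real"
  is "\<lambda>q p' (i, j). (q i - q j) \<bullet> (p' i - p' j)"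
  by (auto simp: inner_diff_left inner_diff_right)

lemma edge_form_Upair [simp]: "edge_form q p' (Upair i j) = (q i - q j) \<bullet> (p' i - p' j)"
  by transfer simp

fun rigidity_map :: "('d::finite) config \<Rightarrow> 'd config \<Rightarrow> 'd rig_row \<Rightarrow> real"
  where
    "rigidity_map (q, b) (p', a') (Inl e) = edge_form q p' e"
  | "rigidity_map (q, b) (p', a') (Inr (i, \<sigma>)) = q i \<bullet> a' \<sigma> + p' i \<bullet> b \<sigma>"

definition rigidity_matrix :: "('d::finite) config \<Rightarrow> 'd rig_row \<Rightarrow> 'd rig_col \<Rightarrow> real"
  where "rigidity_matrix Q r c = rigidity_map Q (unit_config c) r"

definition rigidity_mult ::
  "(real^'d) set \<Rightarrow> 'd config \<Rightarrow> 'd config \<Rightarrow> 'd rig_row \<Rightarrow> real"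
  where "rigidity_mult P Q X r = (\<Sum>c\<in>rigidity_cols P. rigidity_matrix Q r c * coords X c)"

lemma finite_vertices: "polytope P \<Longrightarrow> finite (vertices P)"
  by (simp add: vertices_def finite_polyhedron_extreme_points polytope_imp_polyhedron)

lemma finite_facets: "polytope P \<Longrightarrow> finite (facets P)"
  by (simp add: facets_def finite_polytope_facets)

lemma sum_axis_inner:
  fixes P :: "'a set" and f :: "'a \<Rightarrow> real^'d" and u :: "real^'d"
  assumes "finite P" "i \<in> P"
  shows "(\<Sum>(j, k)\<in>P \<times> UNIV. (u \<bullet> (if i = j then axis k 1 else 0)) * f j $ k) = u \<bullet> f i"
proof -
  have "(\<Sum>(j, k)\<in>P \<times> UNIV. (u \<bullet> (if i = j then axis k 1 else 0)) * f j $ k)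
      = (\<Sum>j\<in>P. \<Sum>k\<in>UNIV. if i = j then u $ k * f j $ k else 0)"
    by (subst sum.cartesian_product[symmetric], intro sum.cong refl) (simp add: inner_axis)
  also have "\<dots> = (\<Sum>j\<in>P. if i = j then u \<bullet> f j else 0)"
    by (intro sum.cong refl) (simp add: inner_vec_def)
  also have "\<dots> = u \<bullet> f i" using assms by simp
  finally show ?thesis .
qed

text \<open>\<open>rigidity_matrix\<close> indeed represents \<open>rigidity_map\<close>.\<close>

lemma rigidity_mult_eq_rigidity_map:
  fixes P :: "(real^'d) set"
  assumes P: "polytope P" and r: "r \<in> rigidity_rows P"
  shows "rigidity_mult P Q X r = rigidity_map Q X r"
proof -
  obtain q b where Q: "Q = (q, b)" by fastforce
  obtain p' a' where X: "X = (p', a')" by fastforce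
  note fin = finite_vertices[OF P] finite_facets[OF P]
  have split: "rigidity_mult P Q X r =
      (\<Sum>c\<in>vertices P \<times> UNIV. rigidity_matrix Q r (Inl c) * coords X (Inl c))
    + (\<Sum>c\<in>facets P \<times> UNIV. rigidity_matrix Q r (Inr c) * coords X (Inr c))"
    using fin by (simp add: rigidity_mult_def rigidity_cols_def sum.Plus)
  show ?thesis
  proof (cases r)
    case (Inl e)
    then obtain i j where e: "e = Upair i j" and ij: "i \<in> vertices P" "j \<in> vertices P"
      using r by (auto simp: rigidity_rows_def edges_def)
    let ?u = "q i - q j"
    have "rigidity_mult P Q X r =
      (\<Sum>(l, k)\<in>vertices P \<times> UNIV. (?u \<bullet> (if i = l then axis k 1 else 0)) * p' l $ k)
      - (\<Sum>(l, k)\<in>vertices P \<times> UNIV. (?u \<bullet> (if j = l then axis k 1 else 0)) * p' l $ k)"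
    proof -
      have "(\<Sum>c\<in>facets P \<times> UNIV. rigidity_matrix Q r (Inr c) * coords X (Inr c)) = 0"
        by (intro sum.neutral) (auto simp: Q X Inl e rigidity_matrix_def)
      moreover have "(\<Sum>c\<in>vertices P \<times> UNIV. rigidity_matrix Q r (Inl c) * coords X (Inl c)) =
          (\<Sum>c\<in>vertices P \<times> UNIV.
            (case c of (l, k) \<Rightarrow> (?u \<bullet> (if i = l then axis k 1 else 0)) * p' l $ k)
            - (case c of (l, k) \<Rightarrow> (?u \<bullet> (if j = l then axis k 1 else 0)) * p' l $ k))"
        by (intro sum.cong refl)
          (auto simp: Q X Inl e rigidity_matrix_def inner_diff_right left_diff_distrib)
      ultimately show ?thesis by (simp only: split sum_subtractf add_0_right)
    qed
    then show ?thesis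
      using ij fin by (simp add: sum_axis_inner Inl e Q X inner_diff_right)
  next
    case (Inr s)
    then obtain i \<sigma> where s: "s = (i, \<sigma>)" and i: "i \<in> vertices P" "\<sigma> \<in> facets P"
      using r by (auto simp: rigidity_rows_def incidences_def)
    have "rigidity_mult P Q X r =
      (\<Sum>(l, k)\<in>vertices P \<times> UNIV. (b \<sigma> \<bullet> (if i = l then axis k 1 else 0)) * p' l $ k)
      + (\<Sum>(l, k)\<in>facets P \<times> UNIV. (q i \<bullet> (if \<sigma> = l then axis k 1 else 0)) * a' l $ k)"
      unfolding split unfolding Q X Inr s rigidity_matrix_def
      by (intro arg_cong2[where f = "(+)"] sum.cong refl) (auto simp: inner_commute)
    then show ?thesis
      using i fin by (simp add: sum_axis_inner Inr s Q X inner_commute)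
  qed
qed


section \<open>First- and second-order motions, stresses\<close>

definition first_order_motion :: "(real^'d) set \<Rightarrow> 'd config \<Rightarrow> bool"
  where "first_order_motion P X \<longleftrightarrow>
    (\<forall>r\<in>rigidity_rows P. rigidity_mult P (polytope_config P) X r = 0)"

definition trivial_motion :: "(real^'d) set \<Rightarrow> 'd config \<Rightarrow> bool"
  where "trivial_motion P X \<longleftrightarrow>
    (\<forall>i\<in>vertices P. \<forall>j\<in>vertices P. (i - j) \<bullet> (fst X i - fst X j) = 0)"

definition first_order_flex :: "(real^'d) set \<Rightarrow> 'd config \<Rightarrow> bool"
  where "first_order_flex P X \<longleftrightarrow> first_order_motion P X \<and> \<not> trivial_motion P X"

definition equilibrium_stress :: "(real^'d) set \<Rightarrow> ('d rig_row \<Rightarrow> real) \<Rightarrow> bool"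
  where "equilibrium_stress P \<xi> \<longleftrightarrow>
    (\<forall>c\<in>rigidity_cols P. (\<Sum>r\<in>rigidity_rows P. rigidity_matrix (polytope_config P) r c * \<xi> r) = 0)"

definition second_order_motion :: "(real^'d) set \<Rightarrow> 'd config \<Rightarrow> 'd config \<Rightarrow> bool"
  where "second_order_motion P X Y \<longleftrightarrow>
    first_order_motion P X \<and>
    (\<forall>i j. Upair i j \<in> edges P \<longrightarrow>
      (i - j) \<bullet> (fst Y i - fst Y j) + (fst X i - fst X j) \<bullet> (fst X i - fst X j) = 0) \<and>
    (\<forall>(i, \<sigma>)\<in>incidences P.
      i \<bullet> snd Y \<sigma> + 2 * (fst X i \<bullet> snd X \<sigma>) + fst Y i \<bullet> facet_normal P \<sigma> = 0)"

definition second_order_rigid :: "(real^'d) set \<Rightarrow> bool"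
  where "second_order_rigid P \<longleftrightarrow> (\<forall>X Y. second_order_motion P X Y \<longrightarrow> trivial_motion P X)"

definition stress_form :: "(real^'d) set \<Rightarrow> ('d rig_row \<Rightarrow> real) \<Rightarrow> 'd config \<Rightarrow> real"
  where "stress_form P \<xi> X = (\<Sum>r\<in>rigidity_rows P. \<xi> r * rigidity_mult P X X r)"

end

theory Submission
  imports Defs
begin

text \<open>For a first-order motion \<open>X\<close>, completing it to a second-order motion means solving
  the linear system \<open>R(P) Y = - R(X) X\<close>. By the Fredholm alternative this is possible iff
  every equilibrium stress, i.e. every element of the kernel of the transpose of \<open>R(P)\<close>,
  is orthogonal to \<open>R(X) X\<close>.\<close>

text \<open>Induction on the set of columns, with \<open>v\<close> arbitrary: the coefficient of a
  new column is fixed first, and the remaining columns then have to solve the system with a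
  corrected right-hand side. The argument needs no dimension count or inner product and works over
  every field.\<close>

lemma linear_system_solvable_if_orthogonal:
  fixes M :: "'r \<Rightarrow> 'c \<Rightarrow> 'a::field" and v :: "'r \<Rightarrow> 'a"
  assumes "finite C" and R: "finite R"
    and "\<And>\<xi>. \<lbrakk>\<And>c. c \<in> C \<Longrightarrow> (\<Sum>r\<in>R. M r c * \<xi> r) = 0\<rbrakk> \<Longrightarrow> (\<Sum>r\<in>R. v r * \<xi> r) = 0"
  shows "\<exists>y. \<forall>r\<in>R. (\<Sum>c\<in>C. M r c * y c) = v r"
  using assms(1,3)
proof (induction C arbitrary: v rule: finite_induct)
  case empty
  have "v r = 0" if "r \<in> R" for r
  proof -
    \<comment> \<open>Without columns every \<open>\<xi>\<close> is admissible, so \<open>v\<close>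
      can be tested against the indicator of \<open>r\<close>.\<close>
    have "(\<Sum>s\<in>R. v s * (if s = r then 1 else 0)) = 0"
      by (rule empty.prems) simp
    also have "(\<Sum>s\<in>R. v s * (if s = r then 1 else 0)) = (\<Sum>s\<in>R. if s = r then v s else 0)"
      by (intro sum.cong) auto
    finally show ?thesis
      using that R by simp
  qed
  then show ?case by simp
next
  case (insert c C)
  \<comment> \<open>The question is whether orthogonality to the columns in \<open>C\<close> already
    forces orthogonality to column \<open>c\<close>. If so, the hypothesis on \<open>v\<close> holds
    for \<open>C\<close> alone and column \<open>c\<close> can get coefficient 0.\<close>
  show ?case
  proof (cases "\<exists>\<xi>. (\<forall>d\<in>C. (\<Sum>r\<in>R. M r d * \<xi> r) = 0) \<and> (\<Sum>r\<in>R. M r c * \<xi> r) \<noteq> 0")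
    case False
    then have "\<exists>y. \<forall>r\<in>R. (\<Sum>d\<in>C. M r d * y d) = v r"
      by (intro insert.IH insert.prems) auto
    then obtain y where y: "\<forall>r\<in>R. (\<Sum>d\<in>C. M r d * y d) = v r" ..
    have "(\<Sum>d\<in>insert c C. M r d * (y(c := 0)) d) = (\<Sum>d\<in>C. M r d * y d)" for r
      using insert.hyps by (auto intro!: sum.cong)
    with y show ?thesis by metis
  next
    case True
    then obtain \<eta> where \<eta>: "\<And>d. d \<in> C \<Longrightarrow> (\<Sum>r\<in>R. M r d * \<eta> r) = 0"
      and \<eta>c: "(\<Sum>r\<in>R. M r c * \<eta> r) \<noteq> 0"
      by blast
    \<comment> \<open>The only possible coefficient of column \<open>c\<close>: pairing the system
      with \<open>\<eta>\<close> kills every column in \<open>C\<close> and leaves one scalar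
      equation.\<close>
    define t where "t = (\<Sum>r\<in>R. v r * \<eta> r) / (\<Sum>r\<in>R. M r c * \<eta> r)"
    have "\<exists>y. \<forall>r\<in>R. (\<Sum>d\<in>C. M r d * y d) = v r - t * M r c"
    proof (rule insert.IH)
      fix \<xi> assume \<xi>: "\<And>d. d \<in> C \<Longrightarrow> (\<Sum>r\<in>R. M r d * \<xi> r) = 0"
      \<comment> \<open>Chosen so that \<open>\<xi> - s * \<eta>\<close> is orthogonal to column
        \<open>c\<close> as well as to \<open>C\<close>; the hypothesis on \<open>v\<close> then
        applies to this combination.\<close>
      define s where "s = (\<Sum>r\<in>R. M r c * \<xi> r) / (\<Sum>r\<in>R. M r c * \<eta> r)"
      have lin: "(\<Sum>r\<in>R. f r * (\<xi> r - s * \<eta> r)) = (\<Sum>r\<in>R. f r * \<xi> r) - s * (\<Sum>r\<in>R. f r * \<eta> r)"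
        for f
        by (simp add: sum_subtractf sum_distrib_left algebra_simps)
      have "(\<Sum>r\<in>R. M r c * \<xi> r) = s * (\<Sum>r\<in>R. M r c * \<eta> r)"
        using \<eta>c by (simp add: s_def)
      then have "(\<Sum>r\<in>R. v r * (\<xi> r - s * \<eta> r)) = 0"
        by (intro insert.prems) (auto simp: lin \<xi> \<eta>)
      then have "(\<Sum>r\<in>R. v r * \<xi> r) = s * (\<Sum>r\<in>R. v r * \<eta> r)"
        by (simp add: lin)
      also have "\<dots> = t * (\<Sum>r\<in>R. M r c * \<xi> r)"
        by (simp add: s_def t_def)
      finally have "(\<Sum>r\<in>R. v r * \<xi> r) = t * (\<Sum>r\<in>R. M r c * \<xi> r)" .
      then show "(\<Sum>r\<in>R. (v r - t * M r c) * \<xi> r) = 0"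
        by (simp add: left_diff_distrib sum_subtractf sum_distrib_left mult.assoc)
    qed
    then obtain y where y: "\<forall>r\<in>R. (\<Sum>d\<in>C. M r d * y d) = v r - t * M r c" ..
    have "(\<Sum>d\<in>insert c C. M r d * (y(c := t)) d) = M r c * t + (\<Sum>d\<in>C. M r d * y d)" for r
      using insert.hyps by (auto intro!: sum.cong)
    with y have "\<forall>r\<in>R. (\<Sum>d\<in>insert c C. M r d * (y(c := t)) d) = v r"
      by simp
    then show ?thesis by blast
  qed
qed

lemma linear_system_solvable_iff_orthogonal:
  fixes M :: "'r \<Rightarrow> 'c \<Rightarrow> 'a::field" and v :: "'r \<Rightarrow> 'a"
  assumes C: "finite C" and R: "finite R"
  shows "(\<exists>y. \<forall>r\<in>R. (\<Sum>c\<in>C. M r c * y c) = v r) \<longleftrightarrow>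
    (\<forall>\<xi>. (\<forall>c\<in>C. (\<Sum>r\<in>R. M r c * \<xi> r) = 0) \<longrightarrow> (\<Sum>r\<in>R. v r * \<xi> r) = 0)"
proof
  assume "\<exists>y. \<forall>r\<in>R. (\<Sum>c\<in>C. M r c * y c) = v r"
  then obtain y where y: "\<And>r. r \<in> R \<Longrightarrow> v r = (\<Sum>c\<in>C. M r c * y c)"
    by metis
  show "\<forall>\<xi>. (\<forall>c\<in>C. (\<Sum>r\<in>R. M r c * \<xi> r) = 0) \<longrightarrow> (\<Sum>r\<in>R. v r * \<xi> r) = 0"
  proof (intro allI impI)
    fix \<xi> assume \<xi>: "\<forall>c\<in>C. (\<Sum>r\<in>R. M r c * \<xi> r) = 0"
    have "(\<Sum>r\<in>R. v r * \<xi> r) = (\<Sum>r\<in>R. \<Sum>c\<in>C. y c * (M r c * \<xi> r))"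
      by (intro sum.cong refl) (simp add: y sum_distrib_left sum_distrib_right mult_ac)
    also have "\<dots> = (\<Sum>c\<in>C. y c * (\<Sum>r\<in>R. M r c * \<xi> r))"
      by (subst sum.swap) (simp add: sum_distrib_left)
    also have "\<dots> = 0"
      using \<xi> by simp
    finally show "(\<Sum>r\<in>R. v r * \<xi> r) = 0" .
  qed
next
  assume "\<forall>\<xi>. (\<forall>c\<in>C. (\<Sum>r\<in>R. M r c * \<xi> r) = 0) \<longrightarrow> (\<Sum>r\<in>R. v r * \<xi> r) = 0"
  then show "\<exists>y. \<forall>r\<in>R. (\<Sum>c\<in>C. M r c * y c) = v r"
    by (intro linear_system_solvable_if_orthogonal C R) auto
qed

lemma finite_edges:
  fixes P :: "(real^'d) set"
  assumes "polytope P"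
  shows "finite (edges P)"
proof (rule finite_subset)
  show "edges P \<subseteq> (\<lambda>(i, j). Upair i j) ` (vertices P \<times> vertices P)"
    by (auto simp: edges_def)
qed (simp add: finite_vertices assms)

lemma finite_incidences:
  fixes P :: "(real^'d) set"
  assumes "polytope P"
  shows "finite (incidences P)"
proof (rule finite_subset)
  show "incidences P \<subseteq> vertices P \<times> facets P"
    by (auto simp: incidences_def)
qed (simp add: finite_vertices finite_facets assms)

lemma finite_rigidity_rows:
  fixes P :: "(real^'d) set"
  shows "polytope P \<Longrightarrow> finite (rigidity_rows P)"
  by (simp add: rigidity_rows_def finite_edges finite_incidences)

lemma finite_rigidity_cols:
  fixes P :: "(real^'d) set"
  shows "polytope P \<Longrightarrow> finite (rigidity_cols P)"
  by (simp add: rigidity_cols_def finite_vertices finite_facets)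

text \<open>Turns a solution of the linear system, which is a function on column indices, back into
  a configuration.\<close>

lemma coords_surj: "\<exists>Y :: ('d::finite) config. coords Y = y"
proof
  show "coords (\<lambda>i. \<chi> k. y (Inl (i, k)), \<lambda>\<sigma>. \<chi> k. y (Inr (\<sigma>, k))) = y"
  proof
    fix c :: "'d rig_col"
    show "coords (\<lambda>i. \<chi> k. y (Inl (i, k)), \<lambda>\<sigma>. \<chi> k. y (Inr (\<sigma>, k))) c = y c"
      by (cases c) auto
  qed
qed

text \<open>The quadratic terms of the second-order equations are the rows of R(X) X. In an
  incidence row both summands of \<open>rigidity_map X X\<close> are the inner product of the vertex
  velocity with the normal velocity, whence the factor 2.\<close>

lemma second_order_motion_iff_rigidity_mult:
  fixes P :: "(real^'d) set"
  assumes P: "polytope P"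
  shows "second_order_motion P X Y \<longleftrightarrow> first_order_motion P X \<and>
    (\<forall>r\<in>rigidity_rows P. rigidity_mult P (polytope_config P) Y r = - rigidity_mult P X X r)"
proof -
  obtain p' a' where X: "X = (p', a')" by fastforce
  obtain p'' a'' where Y: "Y = (p'', a'')" by fastforce
  let ?eq = "\<lambda>r. rigidity_map (polytope_config P) Y r = - rigidity_map X X r"
  have "(\<forall>r\<in>rigidity_rows P.
      rigidity_mult P (polytope_config P) Y r = - rigidity_mult P X X r) \<longleftrightarrow>
    (\<forall>r\<in>rigidity_rows P. ?eq r)"
    using P by (simp add: rigidity_mult_eq_rigidity_map)
  also have "\<dots> \<longleftrightarrow> (\<forall>e\<in>edges P. ?eq (Inl e)) \<and> (\<forall>s\<in>incidences P. ?eq (Inr s))"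
    by (auto simp: rigidity_rows_def)
  \<comment> \<open>Rows are indexed by unordered pairs, whereas \<open>second_order_motion\<close>
    quantifies over their ordered representatives.\<close>
  also have "(\<forall>e\<in>edges P. ?eq (Inl e)) \<longleftrightarrow> (\<forall>i j. Upair i j \<in> edges P \<longrightarrow> ?eq (Inl (Upair i j)))"
  proof (intro iffI ballI allI impI)
    fix e assume *: "\<forall>i j. Upair i j \<in> edges P \<longrightarrow> ?eq (Inl (Upair i j))" and "e \<in> edges P"
    moreover obtain i j where "e = Upair i j"
      by (cases e)
    ultimately show "?eq (Inl e)"
      by simp
  qed simp
  also have "\<dots> \<longleftrightarrow> (\<forall>i j. Upair i j \<in> edges P \<longrightarrow>
      (i - j) \<bullet> (fst Y i - fst Y j) + (fst X i - fst X j) \<bullet> (fst X i - fst X j) = 0)"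
    by (simp add: X Y polytope_config_def eq_neg_iff_add_eq_0)
  also have "(\<forall>s\<in>incidences P. ?eq (Inr s)) \<longleftrightarrow> (\<forall>(i, \<sigma>)\<in>incidences P.
      i \<bullet> snd Y \<sigma> + 2 * (fst X i \<bullet> snd X \<sigma>) + fst Y i \<bullet> facet_normal P \<sigma> = 0)"
    by (intro ball_cong refl) (auto simp: X Y polytope_config_def eq_neg_iff_add_eq_0 algebra_simps)
  finally show ?thesis
    by (simp add: second_order_motion_def)
qed

text \<open>Here \<open>X\<close> is fixed and only \<open>Y\<close> is unknown, so the system is
  linear with matrix R(P). The vectors against which its right-hand side is tested are exactly the
  equilibrium stresses.\<close>

lemma second_order_motion_ex_iff_stress:
  fixes P :: "(real^'d) set"
  assumes P: "polytope P"
  shows "(\<exists>Y. second_order_motion P X Y) \<longleftrightarrow> first_order_motion P X \<and>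
    (\<forall>\<xi>. equilibrium_stress P \<xi> \<longrightarrow> stress_form P \<xi> X = 0)"
proof -
  let ?M = "rigidity_matrix (polytope_config P)" and ?v = "\<lambda>r. - rigidity_mult P X X r"
  have "(\<exists>Y. \<forall>r\<in>rigidity_rows P. rigidity_mult P (polytope_config P) Y r = ?v r) \<longleftrightarrow>
    (\<exists>y. \<forall>r\<in>rigidity_rows P. (\<Sum>c\<in>rigidity_cols P. ?M r c * y c) = ?v r)"
    proof (intro iffI; elim exE)
    fix y assume "\<forall>r\<in>rigidity_rows P. (\<Sum>c\<in>rigidity_cols P. ?M r c * y c) = ?v r"
    moreover obtain Y where "coords Y = y"
      using coords_surj by blast
    ultimately have "\<forall>r\<in>rigidity_rows P. rigidity_mult P (polytope_config P) Y r = ?v r"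
      by (simp add: rigidity_mult_def[where Q = "polytope_config P"])
    then show "\<exists>Y. \<forall>r\<in>rigidity_rows P. rigidity_mult P (polytope_config P) Y r = ?v r" ..
  qed (auto simp: rigidity_mult_def[where Q = "polytope_config P"])
  also have "\<dots> \<longleftrightarrow> (\<forall>\<xi>. equilibrium_stress P \<xi> \<longrightarrow> (\<Sum>r\<in>rigidity_rows P. ?v r * \<xi> r) = 0)"
    unfolding equilibrium_stress_def
    using finite_rigidity_cols[OF P] finite_rigidity_rows[OF P]
    by (rule linear_system_solvable_iff_orthogonal)
  \<comment> \<open>The sign of the right-hand side does not affect whether the pairing
    vanishes.\<close>
  also have "\<dots> \<longleftrightarrow> (\<forall>\<xi>. equilibrium_stress P \<xi> \<longrightarrow> stress_form P \<xi> X = 0)"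
    by (simp add: stress_form_def sum_negf mult.commute)
  finally show ?thesis
    by (simp add: second_order_motion_iff_rigidity_mult[OF P])
qed

theorem theorem4p2:
  fixes P :: "(real^'d) set"
  assumes "polytope P"
    and "aff_dim P = int CARD('d)"
    and "0 \<in> interior P"
  shows "second_order_rigid P \<longleftrightarrow>
    (\<forall>X. first_order_flex P X \<longrightarrow> (\<exists>\<xi>. equilibrium_stress P \<xi> \<and> stress_form P \<xi> X \<noteq> 0))"
proof -
  \<comment> \<open>Triviality depends on \<open>X\<close> alone, so the quantifier over
    \<open>Y\<close> moves into the premise; the contrapositive then speaks of flexes that extend to
    no second-order motion.\<close>
  have "second_order_rigid P \<longleftrightarrow> (\<forall>X. (\<exists>Y. second_order_motion P X Y) \<longrightarrow> trivial_motion P X)"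
    by (auto simp: second_order_rigid_def)
  then show ?thesis
    unfolding second_order_motion_ex_iff_stress[OF assms(1)] first_order_flex_def by blast
qed

end
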